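(* Let $\Gamma\in\mathcal{N}$ be an $n$-symmetric oval. Given $1\le m\le n-1$, there are at least $2\gcd(n,m)$ billiard trajectories in $\Gamma$ of period $\tilde n=n/\gcd(n,m)$. Half of them correspond to regular $\tilde n$-polygons $P_m(\phi)$ of maximum perimeter (among the polygons $P_m(\phi)$, $\phi\in\mathbb{R}$) and the other half to regular $\tilde n$-polygons $P_m(\phi)$ of minimum perimeter. The angle between an arbitrary segment of such a trajectory and the tangent vector at the vertex is $\alpha_m=\frac{m\pi}{n}$.
   Context: Fix an integer $n\ge 2$. An oval is a regular, closed, $C^\infty$ plane curve with strictly positive curvature, parametrized by the angle $\phi\in\mathbb{R}/2\pi\mathbb{Z}$ between its tangent vector $\sigma(\phi)=(\cos\phi,\sin\phi)$ and the positive horizontal axis. It is $n$-symmetric if it is invariant under the rotation by $\frac{2\pi}{n}$ around a point (the symmetry center), taken to be the origin. $\mathcal{N}$ denotes the set of $C^\infty$ $n$-symmetric ovals with symmetry center at the origin. Billiard: a particle moves at constant speed along straight segments inside the region bounded by $\Gamma$ and reflects elastically at $\Gamma$ (angle of incidence equals angle of reflection). Its trajectory is an oriented polygonal line with vertices on $\Gamma$; trajectories differing by orientation are regarded as distinct. The period of a periodic trajectory is its number of impacts. The angle of the outgoing segment at a vertex is measured from the tangent vector $\sigma$ and lies in $(0,\pi)$. For $1\le m\le n-1$ and $\phi\in\mathbb{R}$, $P_m(\phi)$ is the (possibly star-shaped, possibly degenerate to a segment when $\tilde n=2$) regular $\tilde n$-polygon inscribed in $\Gamma$ with successive vertices $\Gamma(\phi),\Gamma(\phi+\frac{2m\pi}{n}),\Gamma(\phi+\frac{4m\pi}{n}),\dots,\Gamma(\phi+\frac{2(\tilde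 n-1)m\pi}{n})$, where $\tilde n=n/\gcd(n,m)$, traversed in this order; thus $P_{n-m}(\phi)$ is $P_m(\phi)$ with the opposite orientation. *)

theory Defs
  imports "HOL-Analysis.Analysis"
begin

text \<open>
  The Euclidean plane is the type complex; the vector \<open>(cos \<phi>, sin \<phi>)\<close> is \<open>cis \<phi>\<close>, and
  multiplication by \<open>cis \<theta>\<close> is the rotation by \<open>\<theta>\<close> around the origin.
\<close>

definition velocity :: "(real \<Rightarrow> complex) \<Rightarrow> real \<Rightarrow> complex" where
  "velocity c = (\<lambda>t. vector_derivative c (at t))"

definition smooth_curve :: "(real \<Rightarrow> complex) \<Rightarrow> bool" where
  "smooth_curve c \<longleftrightarrow> (\<forall>k t. (velocity ^^ k) c differentiable (at t))"

text \<open>Signed curvature \<open>det (c', c'') / |c'|\<^sup>3\<close>; note that \<open>det (z, w) = Im (cnj z * w)\<close>.\<close>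

definition curvature :: "(real \<Rightarrow> complex) \<Rightarrow> real \<Rightarrow> real" where
  "curvature c t = Im (cnj (velocity c t) * velocity (velocity c) t) / norm (velocity c t) ^ 3"

text \<open>
  The last clause says that the parameter is the tangent angle. Together with the period \<open>2 * pi\<close>
  it makes the curve turn exactly once, so simplicity need not be required separately.
\<close>

definition oval :: "(real \<Rightarrow> complex) \<Rightarrow> bool" where
  "oval \<Gamma> \<longleftrightarrow>
     smooth_curve \<Gamma> \<and>
     (\<forall>\<phi>. \<Gamma> (\<phi> + 2 * pi) = \<Gamma> \<phi>) \<and>
     (\<forall>\<phi>. velocity \<Gamma> \<phi> \<noteq> 0) \<and>
     (\<forall>\<phi>. curvature \<Gamma> \<phi> > 0) \<and>
     (\<forall>\<phi>. sgn (velocity \<Gamma> \<phi>) = cis \<phi>)"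

definition symmetric_oval :: "nat \<Rightarrow> (real \<Rightarrow> complex) \<Rightarrow> bool" where
  "symmetric_oval n \<Gamma> \<longleftrightarrow>
     oval \<Gamma> \<and> (\<lambda>z. cis (2 * pi / real n) * z) ` range \<Gamma> = range \<Gamma>"

text \<open>Reflection in the line spanned by the unit vector \<open>s\<close>.\<close>

definition reflect :: "complex \<Rightarrow> complex \<Rightarrow> complex" where
  "reflect s u = (2 * (u \<bullet> s)) *\<^sub>R s - u"

text \<open>
  The bi-infinite sequence of impact points of a billiard particle. An oval is injective modulo
  \<open>2 * pi\<close>, so the tangent direction \<open>cis \<phi>\<close> at the impact point \<open>\<Gamma> \<phi>\<close> does not depend on the
  choice of \<open>\<phi>\<close>.
\<close>

definition billiard_path :: "(real \<Rightarrow> complex) \<Rightarrow> (int \<Rightarrow> complex) \<Rightarrow> bool" where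
  "billiard_path \<Gamma> q \<longleftrightarrow>
     (\<forall>k. q k \<noteq> q (k + 1) \<and> open_segment (q k) (q (k + 1)) \<subseteq> inside (range \<Gamma>)) \<and>
     (\<forall>k. \<exists>\<phi>. q k = \<Gamma> \<phi> \<and>
        sgn (q (k + 1) - q k) = reflect (cis \<phi>) (sgn (q k - q (k - 1))))"

text \<open>
  The oriented polygonal line traced by a sequence of vertices does not remember which vertex comes
  first, so it is represented by the class of the sequence modulo index shifts. Reversing the
  orientation in general gives a different class.
\<close>

definition trajectory :: "(int \<Rightarrow> complex) \<Rightarrow> (int \<Rightarrow> complex) set" where
  "trajectory q = {q'. \<exists>j. \<forall>k. q' k = q (k + j)}"

definition has_least_period :: "nat \<Rightarrow> (int \<Rightarrow> complex) \<Rightarrow> bool" where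
  "has_least_period N q \<longleftrightarrow>
     N > 0 \<and> (\<forall>k. q (k + int N) = q k) \<and>
     (\<forall>j. 0 < j \<and> j < N \<longrightarrow> \<not> (\<forall>k. q (k + int j) = q k))"

definition billiard_trajectories :: "(real \<Rightarrow> complex) \<Rightarrow> nat \<Rightarrow> (int \<Rightarrow> complex) set set" where
  "billiard_trajectories \<Gamma> N =
     {trajectory q | q. billiard_path \<Gamma> q \<and> has_least_period N q}"

text \<open>The angle from the tangent vector \<open>cis \<phi>\<close> counterclockwise to the segment from \<open>p\<close> to \<open>p'\<close>.\<close>

definition outgoing_angle :: "real \<Rightarrow> complex \<Rightarrow> complex \<Rightarrow> real" where
  "outgoing_angle \<phi> p p' = Arg ((p' - p) / cis \<phi>)"

text \<open>The vertices of \<open>P\<^sub>m(\<phi>)\<close>, traversed periodically.\<close>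

definition inscribed_polygon :: "(real \<Rightarrow> complex) \<Rightarrow> nat \<Rightarrow> nat \<Rightarrow> real \<Rightarrow> int \<Rightarrow> complex" where
  "inscribed_polygon \<Gamma> n m \<phi> k = \<Gamma> (\<phi> + 2 * of_int k * real m * pi / real n)"

definition perimeter :: "nat \<Rightarrow> (int \<Rightarrow> complex) \<Rightarrow> real" where
  "perimeter N p = (\<Sum>k<N. dist (p (int k)) (p (int k + 1)))"

text \<open>
  A regular \<open>N\<close>-gon with center \<open>c\<close>, possibly a star polygon (Schlaefli symbol \<open>{N/j}\<close>), possibly
  a segment traversed back and forth (\<open>N = 2\<close>).
\<close>

definition regular_polygon :: "nat \<Rightarrow> (int \<Rightarrow> complex) \<Rightarrow> bool" where
  "regular_polygon N p \<longleftrightarrow>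
     N \<ge> 2 \<and>
     (\<exists>c v j. v \<noteq> 0 \<and> coprime j N \<and>
        (\<forall>k. p k = c + cis (2 * pi * real j * of_int k / real N) * v))"

end

theory Submission
  imports Defs
begin

text \<open>
  The point \<open>\<Gamma>(\<phi>)\<close> is the unique minimizer on the curve of the height \<open>Im (cis (-\<phi>) * z)\<close> in the
  direction of the inner normal. The symmetry permutes these extremal problems, so
  \<open>\<Gamma>(\<phi> + 2\<pi>/n)\<close> is the rotated point \<open>\<Gamma>(\<phi>)\<close>; hence \<open>P\<^sub>m(\<phi>)\<close> is a regular polygon around the origin
  whose perimeter is proportional to \<open>|\<Gamma>(\<phi>)|\<close>. Where \<open>|\<Gamma>|\<close> is extremal, \<open>\<Gamma>(\<phi>)\<close> is orthogonal to
  the tangent, and every side of the polygon makes the angle \<open>m\<pi>/n\<close> with the tangents at its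
  endpoints, which is the reflection law. The translates by \<open>2\<pi>i/n\<close>, \<open>0 \<le> i < gcd n m\<close>, of a
  maximum and of a minimum of \<open>|\<Gamma>|\<close> give the required distinct trajectories.
\<close>

section \<open>Calculus of a curve parametrized by its tangent angle\<close>

text \<open>The tangent-angle clause of \<open>oval\<close> fixes the direction of the velocity, so
  only the speed remains unknown. The derivatives of heights and of the norm are computed from this
  form.\<close>

lemma oval_has_vector_derivative:
  assumes "oval \<Gamma>"
  shows "(\<Gamma> has_vector_derivative of_real (norm (velocity \<Gamma> \<phi>)) * cis \<phi>) (at \<phi>)"
proof -
  have "(velocity ^^ 0) \<Gamma> differentiable (at \<phi>)"
    using assms unfolding oval_def smooth_curve_def by blast
  then have "(\<Gamma> has_vector_derivative velocity \<Gamma> \<phi>) (at \<phi>)"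
    by (simp add: vector_derivative_works velocity_def)
  moreover have "velocity \<Gamma> \<phi> = of_real (norm (velocity \<Gamma> \<phi>)) * sgn (velocity \<Gamma> \<phi>)"
    by (simp add: sgn_eq)
  moreover have "sgn (velocity \<Gamma> \<phi>) = cis \<phi>"
    using assms unfolding oval_def by blast
  ultimately show ?thesis by simp
qed

lemma oval_continuous: "oval \<Gamma> \<Longrightarrow> continuous_on S \<Gamma>"
  by (meson continuous_at_imp_continuous_on has_vector_derivative_continuous
      oval_has_vector_derivative)

lemma oval_speed_pos: "oval \<Gamma> \<Longrightarrow> norm (velocity \<Gamma> \<phi>) > 0"
  by (simp add: oval_def)

lemma oval_periodic: "oval \<Gamma> \<Longrightarrow> \<Gamma> (\<phi> + 2 * pi * of_int k) = \<Gamma> \<phi>"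
proof -
  assume "oval \<Gamma>"
  then have per: "\<Gamma> (\<phi> + 2 * pi) = \<Gamma> \<phi>" for \<phi>
    by (simp add: oval_def)
  show ?thesis
  proof (induction k rule: int_induct[where k = 0])
    case (step1 i)
    then show ?case using per[of "\<phi> + 2 * pi * of_int i"] by (simp add: algebra_simps)
  next
    case (step2 i)
    then show ?case using per[of "\<phi> + 2 * pi * of_int (i - 1)"] by (simp add: algebra_simps)
  qed simp
qed

lemma real_reduce_period:
  fixes t \<phi> :: real
  obtains k :: int where "\<phi> \<le> t + 2 * pi * of_int k" "t + 2 * pi * of_int k < \<phi> + 2 * pi"
proof
  let ?x = "(t - \<phi>) / (2 * pi)"
  have "t - \<phi> = 2 * pi * ?x" by simp
  moreover have "2 * pi * of_int \<lfloor>?x\<rfloor> \<le> 2 * pi * ?x"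
    by (rule mult_left_mono) auto
  moreover have "2 * pi * ?x < 2 * pi * (of_int \<lfloor>?x\<rfloor> + 1)"
    by (rule mult_strict_left_mono) (auto intro: floor_correct[THEN conjunct2])
  ultimately show "\<phi> \<le> t + 2 * pi * of_int (- \<lfloor>?x\<rfloor>)" "t + 2 * pi * of_int (- \<lfloor>?x\<rfloor>) < \<phi> + 2 * pi"
    by (auto simp: algebra_simps simp del: of_int_floor_le)
qed

section \<open>Supporting lines, injectivity and chords\<close>

text \<open>The height over the tangent line at \<phi> has derivative
  \<open>r t * sin (t - \<phi>)\<close> with positive \<open>r\<close>. It rises during the first
  half turn and falls during the second one, back to its initial value at
  \<open>\<phi> + 2 * pi\<close>.\<close>

lemma oval_above_tangent:
  assumes "oval \<Gamma>" "\<phi> < t" "t < \<phi> + 2 * pi"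
  shows "Im (cis (- \<phi>) * \<Gamma> \<phi>) < Im (cis (- \<phi>) * \<Gamma> t)"
proof -
  define g where "g = (\<lambda>t. Im (cis (- \<phi>) * \<Gamma> t))"
  define r where "r = (\<lambda>t. norm (velocity \<Gamma> t))"
  have r: "r t > 0" for t
    unfolding r_def by (rule oval_speed_pos[OF assms(1)])
  have g': "(g has_real_derivative r t * sin (t - \<phi>)) (at t)" for t
  proof -
    have "(g has_vector_derivative Im (cis (- \<phi>) * (of_real (r t) * cis t))) (at t)"
      unfolding g_def r_def
      by (intro bounded_linear.has_vector_derivative[OF bounded_linear_Im]
          has_vector_derivative_mult_right
          oval_has_vector_derivative assms)
    moreover have "Im (cis (- \<phi>) * (of_real (r t) * cis t)) = r t * sin (t - \<phi>)"
      by (simp add: sin_diff algebra_simps)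
    ultimately show ?thesis
      by (simp add: has_real_derivative_iff_has_vector_derivative)
  qed
  have gcont: "continuous_on S g" for S
    using g' by (meson DERIV_isCont continuous_at_imp_continuous_on)
  have "g \<phi> < g t"
  proof (cases "t \<le> \<phi> + pi")
    case True
    show ?thesis
    proof (rule DERIV_pos_imp_increasing_open[OF \<open>\<phi> < t\<close> _ gcont])
      fix x assume "\<phi> < x" "x < t"
      then have "sin (x - \<phi>) > 0" using True by (intro sin_gt_zero) auto
      then show "\<exists>y. (g has_real_derivative y) (at x) \<and> y > 0" using g' r by fastforce
    qed
  next
    case False
    have "g (\<phi> + 2 * pi) < g t"
    proof (rule DERIV_neg_imp_decreasing_open[OF assms(3) _ gcont])
      fix x assume "t < x" "x < \<phi> + 2 * pi"
      then have "sin (x - \<phi>) < 0" using False by (intro sin_lt_zero) auto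
      then show "\<exists>y. (g has_real_derivative y) (at x) \<and> y < 0"
        using g' r by (meson mult_pos_neg)
    qed
    moreover have "g (\<phi> + 2 * pi) = g \<phi>"
      using oval_periodic[OF assms(1), of \<phi> 1] by (simp add: g_def)
    ultimately show ?thesis by simp
  qed
  then show ?thesis by (simp add: g_def)
qed

text \<open>Periodicity moves any parameter into the window from \<open>\<phi>\<close> to
  \<open>\<phi> + 2 * pi\<close>. Since the hypothesis compares points and not parameters, it
  excludes the left end of the window.\<close>

lemma oval_supporting_line:
  assumes "oval \<Gamma>" "\<Gamma> t \<noteq> \<Gamma> \<phi>"
  shows "Im (cis (- \<phi>) * \<Gamma> \<phi>) < Im (cis (- \<phi>) * \<Gamma> t)"
proof -
  obtain k :: int where k: "\<phi> \<le> t + 2 * pi * of_int k" "t + 2 * pi * of_int k < \<phi> + 2 * pi"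
    by (rule real_reduce_period)
  have "\<Gamma> (t + 2 * pi * of_int k) = \<Gamma> t" by (rule oval_periodic[OF assms(1)])
  then show ?thesis
    using oval_above_tangent[OF assms(1), of \<phi> "t + 2 * pi * of_int k"] k assms(2) by fastforce
qed

lemma oval_supporting_line_weak:
  assumes "oval \<Gamma>"
  shows "Im (cis (- \<phi>) * \<Gamma> \<phi>) \<le> Im (cis (- \<phi>) * \<Gamma> t)"
  using oval_supporting_line[OF assms]
  by (cases "\<Gamma> t = \<Gamma> \<phi>") (auto simp del: times_complex.sel intro: less_imp_le)

text \<open>A second parameter of the same point inside the open window would contradict the strict
  height inequality. This is the simplicity of the curve, which \<open>oval\<close> does not
  state.\<close>

lemma oval_inj_mod_period:
  assumes "oval \<Gamma>" "\<Gamma> t = \<Gamma> \<phi>"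
  obtains k :: int where "t = \<phi> + 2 * pi * of_int k"
proof -
  obtain k :: int where k: "\<phi> \<le> t + 2 * pi * of_int k" "t + 2 * pi * of_int k < \<phi> + 2 * pi"
    by (rule real_reduce_period)
  have "\<Gamma> (t + 2 * pi * of_int k) = \<Gamma> \<phi>" by (simp add: oval_periodic assms)
  then have "t + 2 * pi * of_int k = \<phi>"
    using oval_above_tangent[OF assms(1), of \<phi> "t + 2 * pi * of_int k"] k by fastforce
  then have "t = \<phi> + 2 * pi * of_int (- k)" by simp
  then show ?thesis by (rule that)
qed

text \<open>
  The open half planes on the left of all tangent lines intersect in a bounded set whose frontier
  lies on the curve: at a frontier point some tangent height vanishes and is minimal in \<open>\<phi>\<close>, and
  then the derivative in \<open>\<phi>\<close> forces the point to be the point of tangency.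
\<close>

lemma oval_chord_inside:
  assumes "oval \<Gamma>" "\<Gamma> s \<noteq> \<Gamma> t"
  shows "open_segment (\<Gamma> s) (\<Gamma> t) \<subseteq> inside (range \<Gamma>)"
proof
  \<comment> \<open>\<open>f p \<phi>\<close> is the signed distance of \<open>p\<close> from the
    tangent line at \<phi>, positive on the left.\<close>
  define f where "f = (\<lambda>p \<phi>. Im (cis (- \<phi>) * (p - \<Gamma> \<phi>)))"
  define U where "U = {p. \<forall>\<phi>. f p \<phi> > 0}"
  have f_shift: "f q \<phi> = f p \<phi> + Im (cis (- \<phi>) * (q - p))" for p q \<phi>
    by (simp add: f_def algebra_simps)
  have f_lip: "\<bar>f q \<phi> - f p \<phi>\<bar> \<le> dist p q" for p q \<phi>
    using abs_Im_le_cmod[of "cis (- \<phi>) * (q - p)"] f_shift[of q \<phi> p]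
    by (simp add: norm_mult dist_norm norm_minus_commute)
  \<comment> \<open>The point of tangency moves along the tangent line and so does not change the
    height; only the rotation of the line contributes.\<close>
  have f_deriv: "(f q has_real_derivative - Re (cis (- \<phi>) * (q - \<Gamma> \<phi>))) (at \<phi>)" for q \<phi>
  proof -
    have "((\<lambda>\<phi>. q - \<Gamma> \<phi>) has_vector_derivative
        0 - of_real (norm (velocity \<Gamma> \<phi>)) * cis \<phi>) (at \<phi>)"
      by (intro has_vector_derivative_diff has_vector_derivative_const
          oval_has_vector_derivative assms)
    moreover have "((\<lambda>\<phi>. cis (- \<phi>)) has_vector_derivative - (\<i> * cis (- \<phi>))) (at \<phi>)"
    proof -
      have "((\<lambda>z. exp (- (\<i> * z))) has_field_derivative - (\<i> * exp (- (\<i> * of_real \<phi>))))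
          (at (of_real \<phi>))"
        by (auto intro!: derivative_eq_intros)
      from has_vector_derivative_real_field[OF this] show ?thesis
        by (simp add: cis_conv_exp)
    qed
    ultimately have "(f q has_vector_derivative
        Im (cis (- \<phi>) * (0 - of_real (norm (velocity \<Gamma> \<phi>)) * cis \<phi>)
          + - (\<i> * cis (- \<phi>)) * (q - \<Gamma> \<phi>))) (at \<phi>)"
      unfolding f_def
      by (intro bounded_linear.has_vector_derivative[OF bounded_linear_Im]
          has_vector_derivative_mult)
    moreover have "Im (cis (- \<phi>) * (0 - of_real (norm (velocity \<Gamma> \<phi>)) * cis \<phi>)
          + - (\<i> * cis (- \<phi>)) * (q - \<Gamma> \<phi>)) = - Re (cis (- \<phi>) * (q - \<Gamma> \<phi>))"
      by (simp add: algebra_simps)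
    ultimately show ?thesis
      by (simp only: has_real_derivative_iff_has_vector_derivative)
  qed
  have f_cont: "continuous_on S (f q)" for S q
    using f_deriv by (meson DERIV_isCont continuous_at_imp_continuous_on)
  have f_per: "f q (\<phi> + 2 * pi * of_int k) = f q \<phi>" for q \<phi> k
  proof -
    have "cis (2 * pi * of_int (- k)) = 1" by (rule cis_multiple_2pi) simp
    then have "cis (- (\<phi> + 2 * pi * of_int k)) = cis (- \<phi>)"
      using cis_mult[of "- \<phi>" "2 * pi * of_int (- k)"] by simp
    then show ?thesis by (simp only: f_def oval_periodic[OF assms(1)])
  qed
  have min: "\<exists>\<phi>. \<forall>\<psi>. f q \<phi> \<le> f q \<psi>" for q
  proof -
    have "{0..2*pi} \<noteq> {}" by simp
    then obtain \<phi> where \<phi>: "\<forall>\<psi>\<in>{0..2*pi}. f q \<phi> \<le> f q \<psi>"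
      using continuous_attains_inf[OF compact_Icc _ f_cont] by blast
    have "f q \<phi> \<le> f q \<psi>" for \<psi>
    proof -
      obtain k :: int where "0 \<le> \<psi> + 2 * pi * of_int k" "\<psi> + 2 * pi * of_int k < 0 + 2 * pi"
        by (rule real_reduce_period)
      then show ?thesis using bspec[OF \<phi>, of "\<psi> + 2 * pi * of_int k"] f_per by simp
    qed
    then show ?thesis by blast
  qed
  have frontier: "frontier U \<subseteq> range \<Gamma>"
  proof
    fix q assume q: "q \<in> frontier U"
    have nonneg: "f q \<phi> \<ge> 0" for \<phi>
    proof (rule ccontr)
      assume "\<not> f q \<phi> \<ge> 0"
      then obtain p where p: "p \<in> U" "dist p q < - f q \<phi>"
        using q by (metis closure_approachable frontier_def DiffD1 neg_0_less_iff_less not_le)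
      then show False using f_lip[of q \<phi> p] by (auto simp: U_def dest: spec[of _ \<phi>])
    qed
    obtain \<phi> where \<phi>: "\<And>\<psi>. f q \<phi> \<le> f q \<psi>" using min by blast
    have "f q \<phi> = 0"
    proof (rule ccontr)
      assume "f q \<phi> \<noteq> 0"
      then have pos: "f q \<phi> > 0" using nonneg[of \<phi>] by simp
      \<comment> \<open>Heights are 1-Lipschitz in the point, uniformly in the angle, so a positive
        minimal height is the radius of a ball inside \<open>U\<close>.\<close>
      have "ball q (f q \<phi>) \<subseteq> U"
      proof
        fix p assume "p \<in> ball q (f q \<phi>)"
        then have "f p \<psi> > 0" for \<psi>
          using f_lip[of p \<psi> q] \<phi>[of \<psi>] by auto
        then show "p \<in> U" by (simp add: U_def)
      qed
      then have "q \<in> interior U" using pos mem_interior by blast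
      then show False using q by (simp add: frontier_def)
    qed
    moreover have "- Re (cis (- \<phi>) * (q - \<Gamma> \<phi>)) = 0"
      using DERIV_local_min[OF f_deriv, of 1] \<phi> by auto
    ultimately have "cis (- \<phi>) * (q - \<Gamma> \<phi>) = 0"
      by (intro complex_eqI) (auto simp: f_def)
    then show "q \<in> range \<Gamma>" by simp
  qed
  have bounded: "bounded U"
  proof (rule boundedI)
    fix p assume "p \<in> U"
    then have "f p \<phi> > 0" for \<phi> by (simp add: U_def)
    \<comment> \<open>The four horizontal and vertical tangents enclose a rectangle.\<close>
    from this[of 0] this[of "pi/2"] this[of pi] this[of "- pi/2"]
    have "\<bar>Re p\<bar> \<le> \<bar>Re (\<Gamma> (pi/2))\<bar> + \<bar>Re (\<Gamma> (- pi/2))\<bar>" "\<bar>Im p\<bar> \<le> \<bar>Im (\<Gamma> 0)\<bar> + \<bar>Im (\<Gamma> pi)\<bar>"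
      by (auto simp: f_def)
    then show "norm p \<le> \<bar>Re (\<Gamma> (pi/2))\<bar> + \<bar>Re (\<Gamma> (- pi/2))\<bar> + (\<bar>Im (\<Gamma> 0)\<bar> + \<bar>Im (\<Gamma> pi)\<bar>)"
      using cmod_le[of p] by linarith
  qed
  fix p assume "p \<in> open_segment (\<Gamma> s) (\<Gamma> t)"
  then obtain u where u: "0 < u" "u < 1" and p: "p = (1 - u) *\<^sub>R \<Gamma> s + u *\<^sub>R \<Gamma> t"
    by (auto simp: in_segment)
  have pU: "p \<in> U"
  proof -
    have "f p \<phi> > 0" for \<phi>
    proof -
      have le: "f (\<Gamma> s) \<phi> \<ge> 0" "f (\<Gamma> t) \<phi> \<ge> 0"
        using oval_supporting_line_weak[OF assms(1), of \<phi>] by (simp_all add: f_def algebra_simps)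
      \<comment> \<open>A tangent line meets the curve in a single point, so it cannot contain both
        ends of the chord.\<close>
      have "f (\<Gamma> s) \<phi> > 0 \<or> f (\<Gamma> t) \<phi> > 0"
        using oval_supporting_line[OF assms(1), of s \<phi>] oval_supporting_line[OF assms(1), of t \<phi>]
          assms(2) by (cases "\<Gamma> s = \<Gamma> \<phi>") (simp_all add: f_def algebra_simps)
      then have "(1 - u) * f (\<Gamma> s) \<phi> + u * f (\<Gamma> t) \<phi> > 0"
        using u le by (auto intro: add_pos_nonneg add_nonneg_pos)
      moreover have "f p \<phi> = (1 - u) * f (\<Gamma> s) \<phi> + u * f (\<Gamma> t) \<phi>"
        unfolding p f_def by (simp add: algebra_simps)
      ultimately show ?thesis by simp
    qed
    then show ?thesis by (simp add: U_def)
  qed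
  have disj: "U \<inter> range \<Gamma> = {}"
  proof -
    have "f (\<Gamma> \<phi>) \<phi> = 0" for \<phi> by (simp add: f_def)
    then have "\<Gamma> \<phi> \<notin> U" for \<phi> unfolding U_def by (metis mem_Collect_eq less_irrefl)
    then show ?thesis by blast
  qed
  \<comment> \<open>A connected set avoiding the curve cannot leave \<open>U\<close>, because it
    would have to cross the frontier of \<open>U\<close>, which lies on the curve. Hence the
    component of \<open>p\<close> is bounded.\<close>
  let ?C = "connected_component_set (- range \<Gamma>) p"
  have "?C \<subseteq> U"
  proof (rule ccontr)
    assume "\<not> ?C \<subseteq> U"
    then have "?C - U \<noteq> {}" by blast
    moreover have "p \<in> ?C" using pU disj by (auto intro: connected_component_refl)
    then have "?C \<inter> U \<noteq> {}" using pU by blast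
    ultimately have "?C \<inter> frontier U \<noteq> {}"
      by (intro connected_Int_frontier connected_connected_component)
    then show False using frontier connected_component_subset[of "- range \<Gamma>" p] by blast
  qed
  then have "bounded ?C" using bounded bounded_subset by blast
  then show "p \<in> inside (range \<Gamma>)"
    using pU disj by (auto simp: inside_def)
qed

section \<open>Rotational symmetry in terms of the parameter\<close>

lemma cis_mult_left: "cis a * (cis b * z) = cis (a + b) * z"
  by (simp add: cis_mult flip: mult.assoc)

text \<open>\<open>symmetric_oval\<close> speaks only of the image of the curve; parametrization by
  the tangent angle upgrades this to an identity between parametrizations. Negative \<open>k\<close>
  are included to reach backward neighbours.\<close>

lemma symmetric_oval_rotate:
  assumes "symmetric_oval n \<Gamma>"
  shows "\<Gamma> (\<phi> + 2 * pi * of_int k / real n) = cis (2 * pi * of_int k / real n) * \<Gamma> \<phi>"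
proof -
  define \<theta> where "\<theta> = 2 * pi / real n"
  have ov: "oval \<Gamma>" and rot: "(\<lambda>z. cis \<theta> * z) ` range \<Gamma> = range \<Gamma>"
    using assms by (auto simp: symmetric_oval_def \<theta>_def)
  have step: "\<Gamma> (\<phi> + \<theta>) = cis \<theta> * \<Gamma> \<phi>" for \<phi>
  proof -
    obtain s where s: "cis \<theta> * \<Gamma> \<phi> = \<Gamma> s" using rot by blast
    obtain u where u: "\<Gamma> (\<phi> + \<theta>) = cis \<theta> * \<Gamma> u" using rot by (metis imageE rangeI)
    have c: "cis (- (\<phi> + \<theta>)) * (cis \<theta> * z) = cis (- \<phi>) * z" for z
      by (simp add: cis_mult_left)
    \<comment> \<open>Turning point and direction together preserves heights, so this is the
      minimality of \<open>\<Gamma> \<phi>\<close> compared with \<open>\<Gamma> u\<close>. The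
      rotated point is therefore lowest in the turned direction, and the lowest point is
      unique.\<close>
    have "Im (cis (- (\<phi> + \<theta>)) * \<Gamma> s) \<le> Im (cis (- (\<phi> + \<theta>)) * \<Gamma> (\<phi> + \<theta>))"
      unfolding u s[symmetric] c by (rule oval_supporting_line_weak[OF ov])
    then show ?thesis
      using oval_supporting_line[OF ov, of s "\<phi> + \<theta>"] s by force
  qed
  have "\<Gamma> (\<phi> + of_int k * \<theta>) = cis (of_int k * \<theta>) * \<Gamma> \<phi>"
  proof (induction k rule: int_induct[where k = 0])
    case (step1 i)
    have e: "\<Gamma> (\<phi> + of_int (i + 1) * \<theta>) = cis \<theta> * \<Gamma> (\<phi> + of_int i * \<theta>)"
      using step[of "\<phi> + of_int i * \<theta>"] by (simp add: algebra_simps)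
    show ?case unfolding e step1(2) cis_mult_left by (simp add: algebra_simps)
  next
    case (step2 i)
    have "\<Gamma> (\<phi> + of_int i * \<theta>) = cis \<theta> * \<Gamma> (\<phi> + of_int (i - 1) * \<theta>)"
      using step[of "\<phi> + of_int (i - 1) * \<theta>"] by (simp add: algebra_simps)
    then have e: "\<Gamma> (\<phi> + of_int (i - 1) * \<theta>) = cis (- \<theta>) * \<Gamma> (\<phi> + of_int i * \<theta>)"
      by (simp add: cis_mult_left)
    show ?case unfolding e step2(2) cis_mult_left by (simp add: algebra_simps)
  qed simp
  then show ?thesis by (simp add: \<theta>_def mult_ac)
qed

text \<open>
  Adding the heights of the two neighbours \<open>\<Gamma>(\<phi> \<plusminus> 2\<pi>/n)\<close> over the tangent line at \<open>\<phi>\<close> shows that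
  the center lies strictly to the left of that line.
\<close>

lemma symmetric_oval_center_left:
  assumes "symmetric_oval n \<Gamma>" "n \<ge> 2"
  shows "Im (cis (- \<phi>) * \<Gamma> \<phi>) < 0"
proof -
  define \<theta> where "\<theta> = 2 * pi / real n"
  define z where "z = cis (- \<phi>) * \<Gamma> \<phi>"
  have ov: "oval \<Gamma>" using assms by (simp add: symmetric_oval_def)
  have \<theta>: "0 < \<theta>" "\<theta> < 2 * pi" using assms(2) by (auto simp: \<theta>_def field_simps)
  have "Im z < Im (cis \<theta> * z)"
    using oval_above_tangent[OF ov, of \<phi> "\<phi> + \<theta>"] symmetric_oval_rotate[OF assms(1), of \<phi> 1] \<theta>
    by (simp add: z_def \<theta>_def mult.left_commute[of "cis _" "cis _"]
        del: cis.sel times_complex.sel)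
  moreover have "Im z < Im (cis (- \<theta>) * z)"
  proof -
    \<comment> \<open>The backward neighbour needs a parameter between \<open>\<phi>\<close> and
      \<open>\<phi> + 2 * pi\<close>.\<close>
    have "\<Gamma> (\<phi> - \<theta> + 2 * pi) = \<Gamma> (\<phi> - \<theta>)"
      using oval_periodic[OF ov, of "\<phi> - \<theta>" 1] by simp
    moreover have "\<Gamma> (\<phi> - \<theta>) = cis (- \<theta>) * \<Gamma> \<phi>"
      using symmetric_oval_rotate[OF assms(1), of \<phi> "-1"] by (simp add: \<theta>_def)
    ultimately show ?thesis
      using oval_above_tangent[OF ov, of \<phi> "\<phi> - \<theta> + 2 * pi"] \<theta>
      by (simp add: z_def mult.left_commute[of "cis _" "cis _"] del: cis.sel times_complex.sel)
  qed
  \<comment> \<open>The terms with \<open>sin \<theta>\<close> cancel in the sum of the two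
    inequalities.\<close>
  ultimately have "Im z < cos \<theta> * Im z" by simp
  then have "(1 - cos \<theta>) * Im z < 0" by (simp add: algebra_simps)
  then have "Im z < 0" using cos_le_one[of \<theta>]
    by (metis diff_ge_0_iff_ge mult_nonneg_nonneg not_less)
  then show ?thesis by (simp add: z_def)
qed

section \<open>Extrema of the distance from the center\<close>

text \<open>The derivative of the squared norm is
  \<open>2 * r * Re (cis (- \<phi>) * \<Gamma> \<phi>)\<close> with positive speed \<open>r\<close>.
  Its vanishing means that the position vector is orthogonal to the tangent.\<close>

lemma oval_norm_extremum_critical:
  assumes "oval \<Gamma>"
    and "(\<forall>\<psi>. norm (\<Gamma> \<psi>) \<le> norm (\<Gamma> \<phi>)) \<or> (\<forall>\<psi>. norm (\<Gamma> \<phi>) \<le> norm (\<Gamma> \<psi>))"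
  shows "Re (cis (- \<phi>) * \<Gamma> \<phi>) = 0"
proof -
  define r where "r = norm (velocity \<Gamma> \<phi>)"
  define G where "G = (\<lambda>\<psi>. \<Gamma> \<psi> \<bullet> \<Gamma> \<psi>)"
  have r: "r > 0" unfolding r_def by (rule oval_speed_pos[OF assms(1)])
  have "(G has_vector_derivative (\<Gamma> \<phi> \<bullet> (of_real r * cis \<phi>) + (of_real r * cis \<phi>) \<bullet> \<Gamma> \<phi>)) (at \<phi>)"
    unfolding G_def r_def
    by (intro bounded_bilinear.has_vector_derivative[OF bounded_bilinear_inner]
        oval_has_vector_derivative assms)
  then have D: "(G has_real_derivative 2 * r * Re (cis (- \<phi>) * \<Gamma> \<phi>)) (at \<phi>)"
    by (simp add: has_real_derivative_iff_has_vector_derivative inner_complex_def algebra_simps)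
  have "(\<forall>\<psi>. G \<psi> \<le> G \<phi>) \<or> (\<forall>\<psi>. G \<phi> \<le> G \<psi>)"
    using assms(2) by (simp add: G_def norm_le)
  then have "2 * r * Re (cis (- \<phi>) * \<Gamma> \<phi>) = 0"
    using DERIV_local_max[OF D, of 1] DERIV_local_min[OF D, of 1] by auto
  then show ?thesis using r by simp
qed

lemma oval_norm_extrema:
  assumes "oval \<Gamma>"
  obtains a b where "\<forall>t. norm (\<Gamma> t) \<le> norm (\<Gamma> a)" "\<forall>t. norm (\<Gamma> b) \<le> norm (\<Gamma> t)"
proof -
  have cont: "continuous_on {0..2*pi} (\<lambda>t. norm (\<Gamma> t))"
    by (intro continuous_intros oval_continuous assms)
  have ne: "{0..2*pi} \<noteq> {}" by simp
  obtain a where a: "\<forall>t\<in>{0..2*pi}. norm (\<Gamma> t) \<le> norm (\<Gamma> a)"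
    using continuous_attains_sup[OF compact_Icc ne cont] by blast
  obtain b where b: "\<forall>t\<in>{0..2*pi}. norm (\<Gamma> b) \<le> norm (\<Gamma> t)"
    using continuous_attains_inf[OF compact_Icc ne cont] by blast
  have "\<exists>s\<in>{0..2*pi}. \<Gamma> t = \<Gamma> s" for t
  proof -
    obtain k :: int where "0 \<le> t + 2 * pi * of_int k" "t + 2 * pi * of_int k < 0 + 2 * pi"
      by (rule real_reduce_period)
    then show ?thesis
      using oval_periodic[OF assms, of t k]
      by (intro bexI[of _ "t + 2 * pi * of_int k"]) auto
  qed
  then show ?thesis using that[of a b] a b by metis
qed

text \<open>On a circle every point is extremal, so one can shift by half a symmetry step.\<close>

lemma symmetric_oval_norm_extrema:
  assumes "symmetric_oval n \<Gamma>" "n \<ge> 2"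
  obtains a b where "\<forall>t. norm (\<Gamma> t) \<le> norm (\<Gamma> a)" "\<forall>t. norm (\<Gamma> b) \<le> norm (\<Gamma> t)"
    "\<forall>l::int. a \<noteq> b + 2 * pi * of_int l / real n"
proof -
  have ov: "oval \<Gamma>" using assms by (simp add: symmetric_oval_def)
  obtain a b where ab: "\<forall>t. norm (\<Gamma> t) \<le> norm (\<Gamma> a)" "\<forall>t. norm (\<Gamma> b) \<le> norm (\<Gamma> t)"
    by (rule oval_norm_extrema[OF ov])
  show ?thesis
  proof (cases "\<exists>l::int. a = b + 2 * pi * of_int l / real n")
    case True
    \<comment> \<open>A maximum and a minimum related by the symmetry have the same norm, which
      makes the norm constant.\<close>
    then have "norm (\<Gamma> a) = norm (\<Gamma> b)"
      using symmetric_oval_rotate[OF assms(1)] by (auto simp: norm_mult)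
    then have const: "norm (\<Gamma> s) = norm (\<Gamma> t)" for s t
      using ab by (metis order_antisym)
    have "a \<noteq> a + pi / real n + 2 * pi * of_int l / real n" for l :: int
    proof
      assume "a = a + pi / real n + 2 * pi * of_int l / real n"
      then have "pi * (1 + 2 * of_int l) / real n = 0"
        by (simp add: distrib_left add_divide_distrib mult_ac)
      then have "real_of_int (1 + 2 * l) = 0" using assms(2) by simp
      then show False by presburger
    qed
    then show ?thesis using that[of a "a + pi / real n"] const by (metis order_refl)
  next
    case False
    then show ?thesis using that ab by blast
  qed
qed

section \<open>Inscribed polygons: perimeter, regularity, period\<close>

lemma inscribed_polygon_rotate:
  assumes "symmetric_oval n \<Gamma>"
  shows "inscribed_polygon \<Gamma> n m \<phi> k = cis (2 * pi * of_int (k * int m) / real n) * \<Gamma> \<phi>"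
  using symmetric_oval_rotate[OF assms, of \<phi> "k * int m"]
  by (simp add: inscribed_polygon_def mult_ac)

text \<open>All sides are rotated copies of one chord. The factor of
  \<open>norm (\<Gamma> \<phi>)\<close> is independent of \<phi>, so comparing perimeters amounts to
  comparing norms.\<close>

lemma perimeter_inscribed_polygon:
  assumes "symmetric_oval n \<Gamma>"
  shows "perimeter N (inscribed_polygon \<Gamma> n m \<phi>) =
    real N * norm (1 - cis (2 * pi * real m / real n)) * norm (\<Gamma> \<phi>)"
proof -
  let ?w = "cis (2 * pi * real m / real n)"
  have "dist (inscribed_polygon \<Gamma> n m \<phi> k) (inscribed_polygon \<Gamma> n m \<phi> (k + 1)) =
      norm (1 - ?w) * norm (\<Gamma> \<phi>)" for k
  proof -
    let ?v = "cis (2 * pi * of_int (k * int m) / real n)"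
    have "cis (2 * pi * of_int ((k + 1) * int m) / real n) = ?v * ?w"
      by (simp add: cis_mult algebra_simps add_divide_distrib)
    then have "inscribed_polygon \<Gamma> n m \<phi> k - inscribed_polygon \<Gamma> n m \<phi> (k + 1) =
        ?v * (1 - ?w) * \<Gamma> \<phi>"
      unfolding inscribed_polygon_rotate[OF assms] by (simp only: algebra_simps mult_1_left)
    then show ?thesis by (simp add: dist_norm norm_mult)
  qed
  then show ?thesis by (simp add: perimeter_def)
qed

lemma cis_root_of_unity_eq_1_iff:
  assumes "n > 0"
  shows "cis (2 * pi * of_int k / real n) = 1 \<longleftrightarrow> int n dvd k"
proof
  assume "cis (2 * pi * of_int k / real n) = 1"
  then have "cos (2 * pi * of_int k / real n) = 1" by (metis cis.simps(1) one_complex.simps(1))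
  then obtain j :: int where "2 * pi * of_int k / real n = of_int j * 2 * pi"
    using cos_one_2pi_int by auto
  then have "real_of_int k = real_of_int (j * int n)" using assms by (simp add: field_simps)
  then have "k = j * int n" by (simp only: of_int_eq_iff)
  then show "int n dvd k" by simp
next
  assume "int n dvd k"
  then obtain j where "k = int n * j" by blast
  then have "2 * pi * of_int k / real n = 2 * pi * of_int j" using assms by simp
  then show "cis (2 * pi * of_int k / real n) = 1" by (simp add: cis_multiple_2pi)
qed

lemma symmetric_oval_nonzero:
  assumes "symmetric_oval n \<Gamma>" "n \<ge> 2"
  shows "\<Gamma> \<phi> \<noteq> 0"
  using symmetric_oval_center_left[OF assms, of \<phi>] by auto

text \<open>Reducing \<open>m / n\<close> to lowest terms gives the denominator
  \<open>n div g\<close> and the coprime step \<open>m div g\<close>. The denominator is at least 2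
  because \<open>g \<le> m < n\<close>.\<close>

lemma inscribed_polygon_regular:
  assumes "symmetric_oval n \<Gamma>" "n \<ge> 2" "1 \<le> m" "m \<le> n - 1"
  shows "regular_polygon (n div gcd n m) (inscribed_polygon \<Gamma> n m \<phi>)"
proof -
  define g where "g = gcd n m"
  have g: "g > 0" "n = n div g * g" "m = m div g * g" using assms by (auto simp: g_def)
  have "g \<le> m" using assms by (auto simp: g_def intro: dvd_imp_le)
  then have "g < n" using assms by simp
  then have "n div g \<noteq> 0" "n div g \<noteq> 1" using g by (auto simp: div_eq_0_iff)
  then have "n div g \<ge> 2" by linarith
  moreover have "coprime (m div g) (n div g)"
    using div_gcd_coprime[of m n] assms by (simp add: g_def gcd.commute)
  moreover have "real (m div g) / real (n div g) = real m / real n"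
    \<comment> \<open>Only the occurrences on the right-hand side are expanded; then
      \<open>g\<close> cancels.\<close>
    using g(1) by (subst (2) g(2), subst (2) g(3)) simp
  then have "2 * pi * of_int k * (real (m div g) / real (n div g)) =
      2 * pi * of_int k * (real m / real n)" for k :: int by (rule arg_cong)
  then have e: "2 * pi * real (m div g) * of_int k / real (n div g) =
      2 * pi * of_int (k * int m) / real n" for k
    by (simp add: mult_ac)
  have "inscribed_polygon \<Gamma> n m \<phi> k =
      0 + cis (2 * pi * real (m div g) * of_int k / real (n div g)) * \<Gamma> \<phi>" for k
    unfolding inscribed_polygon_rotate[OF assms(1)] e by simp
  ultimately show ?thesis
    using symmetric_oval_nonzero[OF assms(1,2)] unfolding regular_polygon_def g_def[symmetric]
    by blast
qed

text \<open>As \<open>\<Gamma> \<phi>\<close> is nonzero, an index shift by \<open>j\<close> fixes a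
  vertex exactly when \<open>n\<close> divides \<open>j * m\<close>, that is, when
  \<open>n div gcd n m\<close> divides \<open>j\<close>. A single fixed vertex already decides
  this.\<close>

lemma inscribed_polygon_has_least_period:
  assumes "symmetric_oval n \<Gamma>" "n \<ge> 2"
  shows "has_least_period (n div gcd n m) (inscribed_polygon \<Gamma> n m \<phi>)"
proof -
  have per: "inscribed_polygon \<Gamma> n m \<phi> (k + j) = inscribed_polygon \<Gamma> n m \<phi> k \<longleftrightarrow>
      int (n div gcd n m) dvd j" for k j
  proof -
    have "cis (2 * pi * of_int ((k + j) * int m) / real n) =
        cis (2 * pi * of_int (k * int m) / real n) * cis (2 * pi * of_int (j * int m) / real n)"
      by (simp add: cis_mult algebra_simps add_divide_distrib)
    then have "inscribed_polygon \<Gamma> n m \<phi> (k + j) = inscribed_polygon \<Gamma> n m \<phi> k \<longleftrightarrow>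
        cis (2 * pi * of_int (j * int m) / real n) = 1"
      unfolding inscribed_polygon_rotate[OF assms(1)]
      using symmetric_oval_nonzero[OF assms, of \<phi>] by simp
    also have "\<dots> \<longleftrightarrow> int n dvd j * int m"
      using assms(2) by (intro cis_root_of_unity_eq_1_iff) simp
    also have "\<dots> \<longleftrightarrow> int (n div gcd n m) dvd j"
    proof -
      define g where "g = gcd (int n) (int m)"
      have g: "g \<noteq> 0" using assms(2) by (simp add: g_def)
      have "int n = int n div g * g" "int m = int m div g * g" by (auto simp: g_def)
      moreover have "coprime (int n div g) (int m div g)"
        unfolding g_def using assms(2) by (intro div_gcd_coprime) simp
      ultimately have "int n dvd j * int m \<longleftrightarrow> int n div g dvd j"
        using g by (metis coprime_dvd_mult_left_iff dvd_mult_cancel_right mult.assoc)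
      then show ?thesis by (simp add: g_def zdiv_int)
    qed
    finally show ?thesis .
  qed
  have "gcd n m \<le> n" using assms(2) by (intro dvd_imp_le) auto
  then have "n div gcd n m > 0"
    using assms(2) by (simp add: div_greater_zero_iff)
  moreover have "\<not> int (n div gcd n m) dvd int j" if "0 < j" "j < n div gcd n m" for j
    using that by (auto dest: dvd_imp_le)
  ultimately show ?thesis by (auto simp: has_least_period_def per)
qed

section \<open>Polygons at critical parameters as billiard trajectories\<close>

text \<open>Orthogonality gives \<open>\<Gamma> \<phi> = - \<i> * h * cis \<phi>\<close>, where
  \<open>h\<close> is the distance of the center from the tangent line. Multiplying by
  \<open>cis (2 * \<alpha>) - 1\<close> yields a side of length \<open>2 * h * sin \<alpha>\<close>
  whose direction lies midway between the tangent directions at its ends.\<close>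

lemma critical_inscribed_polygon_step:
  assumes "symmetric_oval n \<Gamma>" "n \<ge> 2" "1 \<le> m" "m \<le> n - 1"
    and "Re (cis (- \<phi>) * \<Gamma> \<phi>) = 0"
  shows "\<exists>r>0. \<forall>k. inscribed_polygon \<Gamma> n m \<phi> (k + 1) - inscribed_polygon \<Gamma> n m \<phi> k =
    of_real r * cis (\<phi> + 2 * of_int k * real m * pi / real n + real m * pi / real n)"
proof -
  define \<alpha> where "\<alpha> = real m * pi / real n"
  define h where "h = - Im (cis (- \<phi>) * \<Gamma> \<phi>)"
  have "h > 0" using symmetric_oval_center_left[OF assms(1,2), of \<phi>] by (simp add: h_def)
  have "0 < \<alpha>" "\<alpha> < pi" using assms by (auto simp: \<alpha>_def field_simps)
  then have "sin \<alpha> > 0" by (rule sin_gt_zero)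
  have "cis (- \<phi>) * \<Gamma> \<phi> = - \<i> * of_real h"
    using assms(5) by (intro complex_eqI) (auto simp: h_def)
  then have "cis \<phi> * (cis (- \<phi>) * \<Gamma> \<phi>) = cis \<phi> * (- \<i> * of_real h)" by simp
  then have \<Gamma>: "\<Gamma> \<phi> = - \<i> * of_real h * cis \<phi>" by (simp add: cis_mult_left)
  have chord: "cis (2 * \<alpha>) - 1 = 2 * \<i> * of_real (sin \<alpha>) * cis \<alpha>"
    by (intro complex_eqI) (simp_all add: cos_double_sin sin_double power2_eq_square)
  have "inscribed_polygon \<Gamma> n m \<phi> (k + 1) - inscribed_polygon \<Gamma> n m \<phi> k =
      of_real (2 * h * sin \<alpha>) * cis (\<phi> + 2 * of_int k * real m * pi / real n + \<alpha>)" for k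
  proof -
    let ?v = "cis (2 * of_int k * real m * pi / real n)"
    have "inscribed_polygon \<Gamma> n m \<phi> k = ?v * \<Gamma> \<phi>"
      using inscribed_polygon_rotate[OF assms(1), of m \<phi> k] by (simp add: mult_ac)
    moreover have "inscribed_polygon \<Gamma> n m \<phi> (k + 1) = ?v * cis (2 * \<alpha>) * \<Gamma> \<phi>"
      using inscribed_polygon_rotate[OF assms(1), of m \<phi> "k + 1"]
      by (simp add: \<alpha>_def cis_mult algebra_simps add_divide_distrib)
    ultimately have "inscribed_polygon \<Gamma> n m \<phi> (k + 1) - inscribed_polygon \<Gamma> n m \<phi> k =
        ?v * (cis (2 * \<alpha>) - 1) * \<Gamma> \<phi>" by (simp add: algebra_simps)
    also have "\<dots> = of_real (2 * h * sin \<alpha>) * (cis \<phi> * ?v * cis \<alpha>)"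
      unfolding chord \<Gamma> by (simp add: algebra_simps)
    finally show ?thesis by (simp only: cis_mult)
  qed
  then show ?thesis
    using \<open>h > 0\<close> \<open>sin \<alpha> > 0\<close> unfolding \<alpha>_def by (intro exI[of _ "2 * h * sin \<alpha>"]) (simp add: \<alpha>_def)
qed

lemma reflect_cis: "reflect (cis \<phi>) (cis (\<phi> - \<alpha>)) = cis (\<phi> + \<alpha>)"
proof -
  have "cis (\<phi> - \<alpha>) \<bullet> cis \<phi> = cos \<alpha>"
    using cos_diff[of "\<phi> - \<alpha>" \<phi>] by (simp add: inner_complex_def)
  then show ?thesis
    by (intro complex_eqI) (simp_all add: reflect_def cos_add cos_diff sin_add sin_diff)
qed

lemma critical_inscribed_polygon_billiard_path:
  assumes "symmetric_oval n \<Gamma>" "n \<ge> 2" "1 \<le> m" "m \<le> n - 1"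
    and "Re (cis (- \<phi>) * \<Gamma> \<phi>) = 0"
  shows "billiard_path \<Gamma> (inscribed_polygon \<Gamma> n m \<phi>)"
proof -
  let ?p = "inscribed_polygon \<Gamma> n m \<phi>"
  let ?t = "\<lambda>k. \<phi> + 2 * of_int k * real m * pi / real n"
  let ?\<alpha> = "real m * pi / real n"
  have ov: "oval \<Gamma>" using assms by (simp add: symmetric_oval_def)
  obtain r where "r > 0" and step: "\<And>k. ?p (k + 1) - ?p k = of_real r * cis (?t k + ?\<alpha>)"
    using critical_inscribed_polygon_step[OF assms] by blast
  have sgn: "sgn (?p (k + 1) - ?p k) = cis (?t k + ?\<alpha>)" for k
    unfolding step using \<open>r > 0\<close> by (simp add: sgn_mult sgn_of_real sgn_cis)
  have ne: "?p k \<noteq> ?p (k + 1)" for k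
    using step[of k] \<open>r > 0\<close> by auto
  show ?thesis
    unfolding billiard_path_def
  proof (intro conjI allI exI)
    fix k
    show "?p k \<noteq> ?p (k + 1)" by (rule ne)
    show "open_segment (?p k) (?p (k + 1)) \<subseteq> inside (range \<Gamma>)"
      using ne[of k] unfolding inscribed_polygon_def by (rule oval_chord_inside[OF ov])
    show "?p k = \<Gamma> (?t k)" by (simp add: inscribed_polygon_def)
    \<comment> \<open>Consecutive tangent angles differ by twice the angle \<open>?\<alpha>\<close>,
      so the incoming side makes the same angle with the tangent as the outgoing one.\<close>
    have "?t (k - 1) + ?\<alpha> = ?t k - ?\<alpha>"
      by (simp add: algebra_simps diff_divide_distrib)
    then have "sgn (?p k - ?p (k - 1)) = cis (?t k - ?\<alpha>)"
      using sgn[of "k - 1"] by (simp only: diff_add_cancel)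
    then show "sgn (?p (k + 1) - ?p k) = reflect (cis (?t k)) (sgn (?p k - ?p (k - 1)))"
      by (simp add: sgn reflect_cis)
  qed
qed

text \<open>Any parameter \<psi> of the vertex is allowed: by injectivity it differs from the
  canonical one by full turns, which leave the tangent direction unchanged. The angle lies between 0
  and \<open>pi\<close>, so it is the principal argument.\<close>

lemma critical_inscribed_polygon_outgoing_angle:
  assumes "symmetric_oval n \<Gamma>" "n \<ge> 2" "1 \<le> m" "m \<le> n - 1"
    and "Re (cis (- \<phi>) * \<Gamma> \<phi>) = 0"
    and "inscribed_polygon \<Gamma> n m \<phi> k = \<Gamma> \<psi>"
  shows "outgoing_angle \<psi> (inscribed_polygon \<Gamma> n m \<phi> k) (inscribed_polygon \<Gamma> n m \<phi> (k + 1)) =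
    real m * pi / real n"
proof -
  let ?p = "inscribed_polygon \<Gamma> n m \<phi>"
  let ?t = "\<phi> + 2 * of_int k * real m * pi / real n"
  let ?\<alpha> = "real m * pi / real n"
  have ov: "oval \<Gamma>" using assms by (simp add: symmetric_oval_def)
  obtain r where "r > 0" and step: "?p (k + 1) - ?p k = of_real r * cis (?t + ?\<alpha>)"
    using critical_inscribed_polygon_step[OF assms(1-5)] by blast
  obtain j :: int where j: "?t = \<psi> + 2 * pi * of_int j"
    using oval_inj_mod_period[OF ov] assms(6) unfolding inscribed_polygon_def by blast
  then have "cis ?t = cis \<psi>" by (simp add: cis_multiple_2pi flip: cis_mult)
  then have "cis (?t + ?\<alpha>) = cis \<psi> * cis ?\<alpha>" by (simp flip: cis_mult)
  then have "(?p (k + 1) - ?p k) / cis \<psi> = of_real r * cis ?\<alpha>" by (simp add: step)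
  then have "sgn ((?p (k + 1) - ?p k) / cis \<psi>) = cis ?\<alpha>"
    using \<open>r > 0\<close> by (simp add: sgn_mult sgn_of_real)
  moreover have "0 < ?\<alpha>" "?\<alpha> < pi" using assms by (auto simp: field_simps)
  then have "- pi < ?\<alpha>" "?\<alpha> \<le> pi" using pi_gt_zero by linarith+
  ultimately show ?thesis
    unfolding outgoing_angle_def by (rule cis_Arg_unique)
qed

section \<open>Distinctness of trajectories and the final count\<close>

lemma trajectory_self: "q \<in> trajectory q"
  by (auto simp: trajectory_def intro: exI[of _ 0])

text \<open>Equal trajectories share a vertex, so the parameters differ by \<open>2 * pi / n\<close>
  times some \<open>i * m + k * n\<close>, a multiple of the gcd.\<close>

lemma trajectory_inscribed_polygon_eqD:
  assumes "oval \<Gamma>" "n > 0"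
    and "trajectory (inscribed_polygon \<Gamma> n m \<phi>) = trajectory (inscribed_polygon \<Gamma> n m \<psi>)"
  obtains j :: int where "int (gcd n m) dvd j" "\<phi> = \<psi> + 2 * pi * of_int j / real n"
proof -
  have "inscribed_polygon \<Gamma> n m \<phi> \<in> trajectory (inscribed_polygon \<Gamma> n m \<psi>)"
    using trajectory_self assms(3) by blast
  then obtain i where "inscribed_polygon \<Gamma> n m \<phi> 0 = inscribed_polygon \<Gamma> n m \<psi> (0 + i)"
    unfolding trajectory_def by blast
  then have "\<Gamma> \<phi> = \<Gamma> (\<psi> + 2 * of_int i * real m * pi / real n)"
    by (simp add: inscribed_polygon_def)
  then obtain k :: int where "\<phi> = \<psi> + 2 * of_int i * real m * pi / real n + 2 * pi * of_int k"
    by (rule oval_inj_mod_period[OF assms(1)])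
  then have "\<phi> = \<psi> + 2 * pi * of_int (i * int m + k * int n) / real n"
    using assms(2) by (simp add: field_simps)
  moreover have "int (gcd n m) dvd i * int m + k * int n"
    by (intro dvd_add dvd_mult) auto
  ultimately show ?thesis using that by blast
qed

text \<open>Equality would make \<open>i - j\<close> a multiple of the gcd, while both indices lie
  below it.\<close>

lemma shifted_trajectory_inj:
  fixes i j :: nat
  assumes "oval \<Gamma>" "n > 0" "i < gcd n m" "j < gcd n m"
    and "trajectory (inscribed_polygon \<Gamma> n m (a + 2 * pi * real i / real n)) =
      trajectory (inscribed_polygon \<Gamma> n m (a + 2 * pi * real j / real n))"
  shows "i = j"
proof -
  obtain l :: int where l: "int (gcd n m) dvd l"
    "a + 2 * pi * real i / real n = a + 2 * pi * real j / real n + 2 * pi * of_int l / real n"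
    by (rule trajectory_inscribed_polygon_eqD[OF assms(1,2,5)])
  from l(2) have "2 * pi * real i / real n = 2 * pi * (real j + of_int l) / real n"
    by (simp add: add_divide_distrib distrib_left)
  then have "real i = real j + of_int l" using assms(2) by simp
  then have "int i - int j = l" by linarith
  then have "int i mod int (gcd n m) = int j mod int (gcd n m)"
    using l(1) by (simp add: mod_eq_dvd_iff)
  then show ?thesis using assms(3,4) by (simp flip: zmod_int)
qed

theorem proposition3p1:
  fixes n m :: nat and \<Gamma> :: "real \<Rightarrow> complex"
  assumes "n \<ge> 2"
    and "symmetric_oval n \<Gamma>"
    and "1 \<le> m" and "m \<le> n - 1"
  shows "\<exists>A B.
    A \<union> B \<subseteq> billiard_trajectories \<Gamma> (n div gcd n m) \<and>
    card (A \<union> B) = 2 * gcd n m \<and> card A = gcd n m \<and> card B = gcd n m \<and>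
    (\<forall>T\<in>A. \<exists>\<phi>. T = trajectory (inscribed_polygon \<Gamma> n m \<phi>) \<and>
       regular_polygon (n div gcd n m) (inscribed_polygon \<Gamma> n m \<phi>) \<and>
       (\<forall>\<psi>. perimeter (n div gcd n m) (inscribed_polygon \<Gamma> n m \<psi>)
          \<le> perimeter (n div gcd n m) (inscribed_polygon \<Gamma> n m \<phi>))) \<and>
    (\<forall>T\<in>B. \<exists>\<phi>. T = trajectory (inscribed_polygon \<Gamma> n m \<phi>) \<and>
       regular_polygon (n div gcd n m) (inscribed_polygon \<Gamma> n m \<phi>) \<and>
       (\<forall>\<psi>. perimeter (n div gcd n m) (inscribed_polygon \<Gamma> n m \<phi>)
          \<le> perimeter (n div gcd n m) (inscribed_polygon \<Gamma> n m \<psi>))) \<and>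
    (\<forall>T\<in>A \<union> B. \<forall>q\<in>T. \<forall>k \<phi>. q k = \<Gamma> \<phi> \<longrightarrow>
       outgoing_angle \<phi> (q k) (q (k + 1)) = real m * pi / real n)"
proof -
  let ?g = "gcd n m" and ?N = "n div gcd n m" and ?P = "inscribed_polygon \<Gamma> n m"
  have ov: "oval \<Gamma>" using assms(2) by (simp add: symmetric_oval_def)
  have "n > 0" using assms(1) by simp
  obtain a b where a: "\<forall>t. norm (\<Gamma> t) \<le> norm (\<Gamma> a)" and b: "\<forall>t. norm (\<Gamma> b) \<le> norm (\<Gamma> t)"
    and ab: "\<forall>l::int. a \<noteq> b + 2 * pi * of_int l / real n"
    by (rule symmetric_oval_norm_extrema[OF assms(2,1)])
  \<comment> \<open>The symmetry steps \<open>s c i\<close> preserve the norm, so each extremum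
    \<open>c\<close> yields \<open>?g\<close> extremal parameters; the witnesses are the images of
    \<open>tr a\<close> and \<open>tr b\<close>.\<close>
  define s where "s = (\<lambda>c i. c + 2 * pi * real i / real n)"
  define tr where "tr = (\<lambda>c i. trajectory (?P (s c i)))"
  have shift: "norm (\<Gamma> (s c i)) = norm (\<Gamma> c)" for c i
    using symmetric_oval_rotate[OF assms(2), of c "int i"] by (simp add: s_def norm_mult)
  have crit: "Re (cis (- s c i) * \<Gamma> (s c i)) = 0" if "c \<in> {a, b}" for c i
    using that a b by (intro oval_norm_extremum_critical[OF ov]) (auto simp: shift)
  have bill: "tr c i \<in> billiard_trajectories \<Gamma> ?N" if "c \<in> {a, b}" for c i
    using critical_inscribed_polygon_billiard_path[OF assms(2,1,3,4) crit[OF that]]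
      inscribed_polygon_has_least_period[OF assms(2,1)]
    unfolding tr_def billiard_trajectories_def by blast
  have angle: "outgoing_angle \<phi> (q k) (q (k + 1)) = real m * pi / real n"
    if c: "c \<in> {a, b}" and q: "q \<in> tr c i" "q k = \<Gamma> \<phi>" for c i q k \<phi>
  proof -
    \<comment> \<open>Members of a trajectory are index shifts of one sequence.\<close>
    obtain j where j: "\<And>k. q k = ?P (s c i) (k + j)"
      using q(1) by (auto simp: tr_def trajectory_def)
    have "?P (s c i) (k + j) = \<Gamma> \<phi>" using q(2) j by simp
    from critical_inscribed_polygon_outgoing_angle[OF assms(2,1,3,4) crit[OF c] this]
    show ?thesis by (simp add: j algebra_simps)
  qed
  have perim: "perimeter ?N (?P \<phi>) \<le> perimeter ?N (?P \<psi>)"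
    if "norm (\<Gamma> \<phi>) \<le> norm (\<Gamma> \<psi>)" for \<phi> \<psi>
    unfolding perimeter_inscribed_polygon[OF assms(2)] using that by (intro mult_left_mono) auto
  have inj: "inj_on (tr c) {..<?g}" for c
    using shifted_trajectory_inj[OF ov \<open>n > 0\<close>, of _ m _ c]
    by (auto simp: inj_on_def tr_def s_def)
  \<comment> \<open>A common trajectory would make \<open>a\<close> and \<open>b\<close> differ by a
    multiple of the symmetry step, which their choice excludes even on a circle.\<close>
  have disj: "tr a ` {..<?g} \<inter> tr b ` {..<?g} = {}"
  proof -
    have "tr a i \<noteq> tr b j" for i j
    proof
      assume "tr a i = tr b j"
      then obtain l :: int where "s a i = s b j + 2 * pi * of_int l / real n"
        unfolding tr_def by (rule trajectory_inscribed_polygon_eqD[OF ov \<open>n > 0\<close>])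
      then have "a = b + 2 * pi * of_int (int j + l - int i) / real n"
        using \<open>n > 0\<close> by (simp add: s_def field_simps)
      then show False using ab by blast
    qed
    then show ?thesis by auto
  qed
  have card: "card (tr c ` {..<?g}) = ?g" for c
    by (simp add: card_image inj)
  then have "card (tr a ` {..<?g} \<union> tr b ` {..<?g}) = 2 * ?g"
    using disj by (simp add: card_Un_disjoint)
  moreover have reg: "regular_polygon ?N (?P \<phi>)" for \<phi>
    by (rule inscribed_polygon_regular[OF assms(2,1,3,4)])
  have "\<forall>T\<in>tr a ` {..<?g}. \<exists>\<phi>. T = trajectory (?P \<phi>) \<and> regular_polygon ?N (?P \<phi>) \<and>
      (\<forall>\<psi>. perimeter ?N (?P \<psi>) \<le> perimeter ?N (?P \<phi>))"
    using a reg by (auto simp: tr_def intro!: exI perim simp: shift)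
  moreover have "\<forall>T\<in>tr b ` {..<?g}. \<exists>\<phi>. T = trajectory (?P \<phi>) \<and> regular_polygon ?N (?P \<phi>) \<and>
      (\<forall>\<psi>. perimeter ?N (?P \<phi>) \<le> perimeter ?N (?P \<psi>))"
    using b reg by (auto simp: tr_def intro!: exI perim simp: shift)
  moreover have "tr a ` {..<?g} \<union> tr b ` {..<?g} \<subseteq> billiard_trajectories \<Gamma> ?N"
    using bill by blast
  moreover have "\<forall>T\<in>tr a ` {..<?g} \<union> tr b ` {..<?g}. \<forall>q\<in>T. \<forall>k \<phi>. q k = \<Gamma> \<phi> \<longrightarrow>
      outgoing_angle \<phi> (q k) (q (k + 1)) = real m * pi / real n"
    using angle by blast
  moreover note card[of a] card[of b]
  ultimately show ?thesis
    by (intro exI[of _ "tr a ` {..<?g}"] exI[of _ "tr b ` {..<?g}"] conjI)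
qed

end
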